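(* Let $X$ be a finite set, $\hat S=(s_i)_{i\in I}$ a finite sequence of subsets of $X$, and $\tau:X\to I$ a correspondence. A function $f:X\to\{0,1,2\}$ is a minimal Roman hitting function if and only if all of the following hold: (0) for all $x,y\in f^{-1}(1)$ with $x\ne y$, $\tau(x)\ne\tau(y)$; (1) for all $x\in f^{-1}(1)$, $s_{\tau(x)}\cap f^{-1}(2)=\emptyset$; (2) for every $x\in f^{-1}(2)$ there exists $i\in I\setminus\{\tau(x)\}$ with $s_i\cap f^{-1}(2)=\{x\}$; (3) $f^{-1}(2)$ is a minimal hitting set of the family $\{s_i : i\in I,\ \tau^{-1}(i)\cap f^{-1}(1)=\emptyset\}$.
   Context: A correspondence is a map $\tau:X\to I$ with $x\in s_{\tau(x)}$ for all $x\in X$. A function $f:X\to\{0,1,2\}$ is a Roman hitting function (rhf) if for every $i\in I$ there is $x\in s_i$ with $f(x)=2$ or there is $x\in X$ with $\tau(x)=i$ and $f(x)=1$. Functions are ordered pointwise ($g\le f$ iff $g(x)\le f(x)$ for all $x$); an rhf $f$ is minimal if every rhf $g\le f$ equals $f$. A hitting set of a family of subsets of $X$ is a set meeting every member; it is minimal if no proper subset is a hitting set. *)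

theory Defs
  imports "HOL-Library.FuncSet"
begin

text \<open>
  The ground set, the index set and the sequence of subsets are given by carriers
  \<^term>\<open>X :: 'a set\<close>, \<^term>\<open>I :: 'i set\<close> and a function \<^term>\<open>s :: 'i \<Rightarrow> 'a set\<close>,
  so that empty ground sets and repeated members are covered.  A map on \<^term>\<open>X\<close> is a total
  function of which only the values on \<^term>\<open>X\<close> matter; hence inverse images are
  intersected with \<^term>\<open>X\<close>, and order and equality of maps are taken pointwise on \<^term>\<open>X\<close>.
\<close>

definition correspondence :: "'a set \<Rightarrow> 'i set \<Rightarrow> ('i \<Rightarrow> 'a set) \<Rightarrow> ('a \<Rightarrow> 'i) \<Rightarrow> bool" where
  "correspondence X I s \<tau> \<longleftrightarrow> \<tau> \<in> X \<rightarrow> I \<and> (\<forall>x\<in>X. x \<in> s (\<tau> x))"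

definition roman_hitting_function ::
    "'a set \<Rightarrow> 'i set \<Rightarrow> ('i \<Rightarrow> 'a set) \<Rightarrow> ('a \<Rightarrow> 'i) \<Rightarrow> ('a \<Rightarrow> nat) \<Rightarrow> bool" where
  "roman_hitting_function X I s \<tau> f \<longleftrightarrow>
     f \<in> X \<rightarrow> {0, 1, 2} \<and>
     (\<forall>i\<in>I. (\<exists>x\<in>s i. f x = 2) \<or> (\<exists>x\<in>X. \<tau> x = i \<and> f x = 1))"

definition minimal_roman_hitting_function ::
    "'a set \<Rightarrow> 'i set \<Rightarrow> ('i \<Rightarrow> 'a set) \<Rightarrow> ('a \<Rightarrow> 'i) \<Rightarrow> ('a \<Rightarrow> nat) \<Rightarrow> bool" where
  "minimal_roman_hitting_function X I s \<tau> f \<longleftrightarrow>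
     roman_hitting_function X I s \<tau> f \<and>
     (\<forall>g. roman_hitting_function X I s \<tau> g \<and> (\<forall>x\<in>X. g x \<le> f x) \<longrightarrow> (\<forall>x\<in>X. g x = f x))"

definition hitting_set :: "'a set \<Rightarrow> 'a set set \<Rightarrow> 'a set \<Rightarrow> bool" where
  "hitting_set X F H \<longleftrightarrow> H \<subseteq> X \<and> (\<forall>S\<in>F. S \<inter> H \<noteq> {})"

definition minimal_hitting_set :: "'a set \<Rightarrow> 'a set set \<Rightarrow> 'a set \<Rightarrow> bool" where
  "minimal_hitting_set X F H \<longleftrightarrow>
     hitting_set X F H \<and> (\<forall>H'. H' \<subset> H \<longrightarrow> \<not> hitting_set X F H')"

end

theory Submission
  imports Defs
begin

text \<open>
  Lowering a single value of a minimal Roman hitting function \<open>f\<close> must leave some index uncovered.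
  For a value 1 lowered to 0 this yields (0) and (1); for a value 2 at \<open>x\<close> lowered to 1 the
  uncovered index differs from \<open>\<tau> x\<close>, because the new value 1 covers \<open>\<tau> x\<close>, and yields (2).
  The private index in (2) also gives the minimality in (3), since by (1) no value 1 covers it.
  Conversely, if \<open>g \<le> f\<close> drops at \<open>x\<close>, then the index \<open>\<tau> x\<close> (if \<open>f x = 1\<close>) or the private
  index (if \<open>f x = 2\<close>) is not covered by \<open>g\<close>.
\<close>

lemma minimal_roman_hitting_function_update:
  assumes min: "minimal_roman_hitting_function X I s \<tau> f"
    and x: "x \<in> X" and v: "v < f x"
  obtains i where "i \<in> I" "\<forall>y\<in>s i. (f(x := v)) y \<noteq> 2"
    "\<forall>y\<in>X. \<tau> y = i \<longrightarrow> (f(x := v)) y \<noteq> 1"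
proof -
  have rhf: "roman_hitting_function X I s \<tau> f"
    using min by (simp add: minimal_roman_hitting_function_def)
  have "\<not> roman_hitting_function X I s \<tau> (f(x := v))"
  proof
    assume "roman_hitting_function X I s \<tau> (f(x := v))"
    moreover have "\<forall>y\<in>X. (f(x := v)) y \<le> f y" using v by simp
    ultimately have "\<forall>y\<in>X. (f(x := v)) y = f y"
      using min unfolding minimal_roman_hitting_function_def by blast
    then show False using x v by auto
  qed
  \<comment> \<open>The lowered function still takes values in \<open>{0, 1, 2}\<close>, so what
    fails is the covering condition at some index.\<close>
  moreover have "f x \<in> {0, 1, 2}"
    using rhf x unfolding roman_hitting_function_def by blast
  then have "v \<in> {0, 1, 2}" using v by auto
  then have "f(x := v) \<in> X \<rightarrow> {0, 1, 2}"
    using rhf by (simp add: roman_hitting_function_def Pi_iff)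
  ultimately show thesis
    using that unfolding roman_hitting_function_def by blast
qed

theorem theorem8:
  fixes X :: "'a set" and I :: "'i set" and s :: "'i \<Rightarrow> 'a set"
    and \<tau> :: "'a \<Rightarrow> 'i" and f :: "'a \<Rightarrow> nat"
  assumes "finite X" and "finite I"
    and "\<And>i. i \<in> I \<Longrightarrow> s i \<subseteq> X"
    and "correspondence X I s \<tau>"
    and "f \<in> X \<rightarrow> {0, 1, 2}"
  shows "minimal_roman_hitting_function X I s \<tau> f \<longleftrightarrow>
      (\<forall>x \<in> f -` {1} \<inter> X. \<forall>y \<in> f -` {1} \<inter> X. x \<noteq> y \<longrightarrow> \<tau> x \<noteq> \<tau> y)
    \<and> (\<forall>x \<in> f -` {1} \<inter> X. s (\<tau> x) \<inter> (f -` {2} \<inter> X) = {})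
    \<and> (\<forall>x \<in> f -` {2} \<inter> X. \<exists>i \<in> I - {\<tau> x}. s i \<inter> (f -` {2} \<inter> X) = {x})
    \<and> minimal_hitting_set X
        {s i | i. i \<in> I \<and> (\<tau> -` {i} \<inter> X) \<inter> (f -` {1} \<inter> X) = {}}
        (f -` {2} \<inter> X)"
  (is "_ \<longleftrightarrow> ?C0 \<and> ?C1 \<and> ?C2 \<and> minimal_hitting_set X ?F ?H")
proof
  have self: "x \<in> s (\<tau> x)" "\<tau> x \<in> I" if "x \<in> X" for x
    using assms(4) that unfolding correspondence_def by auto
  {
    assume min: "minimal_roman_hitting_function X I s \<tau> f"
    then have cover: "(\<exists>x\<in>s i. f x = 2) \<or> (\<exists>x\<in>X. \<tau> x = i \<and> f x = 1)" if "i \<in> I" for i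
      using that unfolding minimal_roman_hitting_function_def roman_hitting_function_def by blast
    have lone: "(\<forall>y\<in>X. f y = 1 \<and> y \<noteq> x \<longrightarrow> \<tau> y \<noteq> \<tau> x) \<and> (\<forall>y\<in>s (\<tau> x). f y \<noteq> 2)"
      if x: "x \<in> X" "f x = 1" for x
    proof -
      have "0 < f x" using x by simp
      then obtain i where i: "i \<in> I" "\<forall>y\<in>s i. (f(x := 0)) y \<noteq> 2"
        "\<forall>y\<in>X. \<tau> y = i \<longrightarrow> (f(x := 0)) y \<noteq> 1"
        using minimal_roman_hitting_function_update[OF min x(1)] by blast
      have no2: "\<forall>y\<in>s i. f y \<noteq> 2" and no1: "\<forall>y\<in>X. f y = 1 \<and> y \<noteq> x \<longrightarrow> \<tau> y \<noteq> i"
        using i x by (auto simp: fun_upd_def split: if_splits)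
      \<comment> \<open>\<open>f\<close> itself covers \<open>i\<close>, and by \<open>no2\<close>
        and \<open>no1\<close> only the value 1 at \<open>x\<close> can do so.\<close>
      then have "i = \<tau> x" using cover[OF i(1)] by auto
      then show ?thesis using no1 no2 by simp
    qed
    have "?C0" using lone by auto
    moreover have C1: "?C1" using lone by auto
    moreover have C2: "?C2"
    proof
      fix x assume "x \<in> ?H"
      then have x: "x \<in> X" "f x = 2" by auto
      then have "1 < f x" by simp
      then obtain i where i: "i \<in> I" "\<forall>y\<in>s i. (f(x := 1)) y \<noteq> 2"
        "\<forall>y\<in>X. \<tau> y = i \<longrightarrow> (f(x := 1)) y \<noteq> 1"
        using minimal_roman_hitting_function_update[OF min x(1)] by blast
      have ne: "i \<noteq> \<tau> x" using i(3) x(1) by auto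
      have only: "y = x" if "y \<in> s i" "f y = 2" for y
        using i(2) that by (auto simp: fun_upd_def split: if_splits)
      \<comment> \<open>Raising the 1 at \<open>x\<close> back to 2 creates no new value 1, so
        \<open>f\<close> must cover \<open>i\<close> by a 2, which \<open>only\<close> places at
        \<open>x\<close>.\<close>
      have "\<forall>y\<in>X. \<tau> y = i \<longrightarrow> f y \<noteq> 1"
        using i(3) x by (auto simp: fun_upd_def split: if_splits)
      then have "\<exists>y\<in>s i. f y = 2" using cover[OF i(1)] by blast
      then have "x \<in> s i" using only by blast
      then have "s i \<inter> ?H = {x}" using only x by blast
      then show "\<exists>i \<in> I - {\<tau> x}. s i \<inter> ?H = {x}" using i(1) ne by blast
    qed
    moreover have "minimal_hitting_set X ?F ?H"
      unfolding minimal_hitting_set_def hitting_set_def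
    proof (intro conjI allI impI ballI)
      fix S assume "S \<in> ?F"
      then obtain i where i: "S = s i" "i \<in> I" "\<forall>y\<in>X. \<tau> y = i \<longrightarrow> f y \<noteq> 1" by auto
      then obtain y where "y \<in> s i" "f y = 2" using cover by blast
      then show "S \<inter> ?H \<noteq> {}" using i assms(3)[OF i(2)] by auto
    next
      fix H' assume "H' \<subset> ?H"
      then obtain x where x: "x \<in> ?H" "x \<notin> H'" and sub: "H' \<subseteq> ?H" by blast
      obtain i where i: "i \<in> I" "s i \<inter> ?H = {x}" using C2 x(1) by blast
      \<comment> \<open>A value 1 at a point over \<open>i\<close> would by \<open>C1\<close> keep
        the value 2 out of \<open>s i\<close>, yet \<open>x\<close> lies there. So
        \<open>s i\<close> is in the family, and \<open>H'\<close> misses it.\<close>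
      then have "(\<tau> -` {i} \<inter> X) \<inter> (f -` {1} \<inter> X) = {}" using C1 by fastforce
      then have "s i \<in> ?F" using i(1) by blast
      moreover have "s i \<inter> H' \<subseteq> {x}" unfolding i(2)[symmetric] using sub by blast
      then have "s i \<inter> H' = {}" using x(2) by blast
      ultimately show "\<not> (H' \<subseteq> X \<and> (\<forall>S\<in>?F. S \<inter> H' \<noteq> {}))" by blast
    qed simp
    ultimately show "?C0 \<and> ?C1 \<and> ?C2 \<and> minimal_hitting_set X ?F ?H" by blast
  next
    assume C: "?C0 \<and> ?C1 \<and> ?C2 \<and> minimal_hitting_set X ?F ?H"
    then have C0: "x = y" if "x \<in> X" "y \<in> X" "f x = 1" "f y = 1" "\<tau> x = \<tau> y" for x y
      using that by blast
    have C1: "f y \<noteq> 2" if "x \<in> X" "f x = 1" "y \<in> s (\<tau> x)" for x y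
    proof
      assume "f y = 2"
      moreover have "y \<in> X" using that assms(3)[OF self(2)] by blast
      ultimately show False using C that by blast
    qed
    have hit: "hitting_set X ?F ?H" using C by (simp add: minimal_hitting_set_def)
    have rhf: "roman_hitting_function X I s \<tau> f"
      unfolding roman_hitting_function_def
    proof (intro conjI ballI)
      fix i assume i: "i \<in> I"
      show "(\<exists>x\<in>s i. f x = 2) \<or> (\<exists>x\<in>X. \<tau> x = i \<and> f x = 1)"
      proof (cases "\<exists>x\<in>X. \<tau> x = i \<and> f x = 1")
        case False
        then have "s i \<in> ?F" using i by blast
        then have "s i \<inter> ?H \<noteq> {}" using hit unfolding hitting_set_def by blast
        then show ?thesis by blast
      qed simp
    qed (rule assms(5))
    have "g x = f x"
      if g: "roman_hitting_function X I s \<tau> g" and le: "\<forall>x\<in>X. g x \<le> f x" and x: "x \<in> X" for g x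
    proof (rule ccontr)
      assume "g x \<noteq> f x"
      then have lt: "g x < f x" using le x by (simp add: le_neq_implies_less)
      have f012: "f y \<in> {0, 1, 2}" if "y \<in> X" for y using assms(5) that by blast
      have g2: "f y = 2" if "y \<in> X" "g y = 2" for y
        using le f012[OF that(1)] that by fastforce
      \<comment> \<open>A 1 of \<open>g\<close> may come from a lowered 2 of \<open>f\<close>, so
        \<open>g\<close> could cover indices by a 1 where \<open>f\<close> does not; both cases
        below must exclude this.\<close>
      have g1: "f y = 1 \<or> f y = 2" if "y \<in> X" "g y = 1" for y
        using le f012[OF that(1)] that by fastforce
      have cover: "(\<exists>y\<in>X. y \<in> s i \<and> f y = 2 \<and> g y = 2) \<or> (\<exists>y\<in>X. \<tau> y = i \<and> g y = 1)"
        if "i \<in> I" for i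
        using g that assms(3)[OF that] g2 unfolding roman_hitting_function_def by blast
      consider "f x = 1" | "f x = 2" using f012[OF x] lt by auto
      then show False
      proof cases
        case 1
        then obtain y where y: "y \<in> X" "\<tau> y = \<tau> x" "g y = 1"
          using cover[OF self(2)[OF x]] C1[OF x] by blast
        \<comment> \<open>Here \<open>g x = 0\<close>. By \<open>C0\<close> the value of
          \<open>f\<close> at \<open>y\<close> is not 1, so it is 2; but \<open>y\<close> lies in
          \<open>s (\<tau> y) = s (\<tau> x)\<close>, against \<open>C1\<close>.\<close>
        then have "y \<noteq> x" using lt 1 by auto
        then have "f y = 2" using C0[OF y(1) x] g1[OF y(1,3)] 1 y(2) by blast
        then show False using C1[OF x 1, of y] self(1)[OF y(1)] y(2) by simp
      next
        case 2
        then obtain i where i: "i \<in> I" "i \<noteq> \<tau> x" "s i \<inter> ?H = {x}" using C x by blast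
        \<comment> \<open>The only 2 of \<open>f\<close> on \<open>s i\<close> is at
          \<open>x\<close>, where \<open>g\<close> has dropped.\<close>
        have "\<not> (\<exists>y\<in>X. y \<in> s i \<and> f y = 2 \<and> g y = 2)"
        proof
          assume "\<exists>y\<in>X. y \<in> s i \<and> f y = 2 \<and> g y = 2"
          then obtain y where y: "y \<in> s i \<inter> ?H" "g y = 2" by blast
          then have "y = x" unfolding i(3) by simp
          then show False using y(2) lt 2 by simp
        qed
        then obtain y where y: "y \<in> X" "\<tau> y = i" "g y = 1" using cover[OF i(1)] by blast
        have "x \<in> s i" using i(3) by blast
        \<comment> \<open>If \<open>f y = 1\<close>, then \<open>C1\<close> would forbid the 2 at
          \<open>x\<close> in \<open>s (\<tau> y)\<close>. With \<open>f y = 2\<close>, the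
          correspondence puts \<open>y\<close> into \<open>s i\<close>, which forces
          \<open>y = x\<close> and \<open>i = \<tau> x\<close>.\<close>
        then have "f y = 2" using g1[OF y(1,3)] C1[OF y(1), of x] y(2) 2 by blast
        then have "y \<in> s i \<inter> ?H" using self(1)[OF y(1)] y by simp
        then have "y = x" unfolding i(3) by simp
        then show False using y(2) i(2) by simp
      qed
    qed
    with rhf show "minimal_roman_hitting_function X I s \<tau> f"
      unfolding minimal_roman_hitting_function_def by blast
  }
qed

end
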